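(* Let $\bm y(t)=[y_1(t),\dots,y_N(t)]^\top$, $t\in[0,T]$, denote the solution of $\bm y'(t)=\bm f(\bm y(t))$, $\bm y(0)=\bm y_0\in\mathbb{R}^N_+$, under the assumption that $\mathbb{R}^N_+$ is forward invariant under the flow. Given two integers $M\ge 0$ and $N_k\ge 0$, define $q=\max\{M+1,N_k+1\}$. Assume that $\bm f\in C^q(\Omega)$, where $\Omega$ is a compact subset of $\mathbb{R}^N_+$ such that $$\{\bm\omega=[\omega_1,\dots,\omega_N]^\top:\ 0<\alpha\le\omega_i\le\beta,\ i=1,\dots,N\}\subset\mathring{\Omega},\qquad \alpha=\min_{1\le i\le N,\,0\le t\le T}|y_i(t)|,\quad \beta=\max_{i=1,\dots,N}\|y_i\|_{L^\infty([0,T])},$$ with $\mathring\Omega$ the interior of $\Omega$. Then the SPIDeC method with $M+1$ stages and $N_k$ correction sweeps is consistent with the differential system of order $p=\min\{M+1,N_k+1\}$; that is, its local error satisfies $\max_{i=1,\dots,N}|\delta_i(h;t_{n+1})|=\mathcal{O}(h^{p+1})$ as $h\to0$, uniformly in $n$.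
   Context: $\mathbb{R}^N_+=\{\bm\eta\in\mathbb{R}^N:\eta_i>0\ \forall i\}$; $\bm f=[f_1,\dots,f_N]^\top$ is a sufficiently smooth $\mathbb{R}^N$-valued function defined on an open set containing $\mathbb{R}^N_+$. Forward invariance means that solutions starting in $\mathbb{R}^N_+$ remain in $\mathbb{R}^N_+$ for all $t\in[0,T]$. Let $t_n=nh$, $n=0,\dots,N_t$, $h=T/N_t$. Let $0\le\tau_0<\tau_1<\dots<\tau_M=1$ be fixed quadrature nodes with Lagrange basis polynomials $\ell_0,\dots,\ell_M$ (of degree at most $M$), $t_{n,m}=t_n+\tau_m h$, and $Q_{m,j}=\int_0^{\tau_m}\ell_j(\tau)\,d\tau$ for $m,j=0,\dots,M$. The SPIDeC scheme with $M+1$ stages and $N_k$ correction sweeps is, for $i=1,\dots,N$, $m=0,\dots,M$, starting from $y_i^0=y_i(0)$: $$y^{n,m}_{i(0)}=y_i^n\exp\Big(h\tau_m\frac{f_i(\bm y^n)}{y_i^n}\Big),\qquad y^{n,m}_{i(k)}=y_i^n\exp\Big(h\sum_{j=0}^M Q_{m,j}\frac{f_i(\bm y^{n,j}_{(k-1)})}{y^{n,j}_{i(k-1)}}\Big),\quad k=1,\dots,N_k,\qquad y_i^{n+1}=y^{n,M}_{i(N_k)}.$$ Local error: it is obtained by applying one step of the scheme to exact data. Define $$y_{i(0)}(t_{n,m})=y_i(t_n)\exp\Big(h\tau_m\frac{f_i(\bm y(t_n))}{y_i(t_n)}\Big),\qquad y_{i(k)}(t_{n,m})=y_i(t_n)\exp\Big(h\sum_{j=0}^M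 Q_{m,j}\frac{f_i(\bm y_{(k-1)}(t_{n,j}))}{y_{i(k-1)}(t_{n,j})}\Big),\quad k=1,\dots,N_k,$$ and $\delta_i(h;t_{n+1})=y_i(t_{n+1})-y_{i(N_k)}(t_{n+1})$, where $y_{i(N_k)}(t_{n+1})=y_{i(N_k)}(t_{n,M})$. *)

theory Defs
  imports "HOL-Analysis.Analysis" "HOL-Probability.Essential_Supremum"
begin

definition pos_orthant :: "(real^'n) set" where
  "pos_orthant = {x. \<forall>i. 0 < x $ i}"

(* The class C^k(S) for a set S that need not be open: all derivatives of order at most k exist
   on the interior of S, and they (and f itself) are continuous there with a continuous extension
   to S.  The function f' is the Frechet derivative on the interior and, elsewhere on S, the
   continuous extension of it; f' _ v is the directional derivative along v, so in finite dimension
   quantifying over v amounts to quantifying over the partial derivatives. *)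
primrec Ck_on :: "nat \<Rightarrow> 'a::euclidean_space set \<Rightarrow> ('a \<Rightarrow> 'b::euclidean_space) \<Rightarrow> bool" where
  "Ck_on 0 S f \<longleftrightarrow> continuous_on S f"
| "Ck_on (Suc k) S f \<longleftrightarrow> continuous_on S f \<and>
     (\<exists>f'. (\<forall>x\<in>interior S. (f has_derivative f' x) (at x)) \<and> (\<forall>v. Ck_on k S (\<lambda>x. f' x v)))"

(* D is the domain of f; the values of f outside D are irrelevant. *)
definition ode_solution ::
  "(real^'n) set \<Rightarrow> (real^'n \<Rightarrow> real^'n) \<Rightarrow> real \<Rightarrow> (real \<Rightarrow> real^'n) \<Rightarrow> bool" where
  "ode_solution D f T u \<longleftrightarrow>
     (\<forall>t\<in>{0..T}. u t \<in> D \<and> (u has_vector_derivative f (u t)) (at t within {0..T}))"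

definition forward_invariant ::
  "(real^'n) set \<Rightarrow> (real^'n) set \<Rightarrow> (real^'n \<Rightarrow> real^'n) \<Rightarrow> real \<Rightarrow> bool" where
  "forward_invariant P D f T \<longleftrightarrow>
     (\<forall>u. ode_solution D f T u \<longrightarrow> u 0 \<in> P \<longrightarrow> (\<forall>t\<in>{0..T}. u t \<in> P))"

definition Linf_norm :: "real set \<Rightarrow> (real \<Rightarrow> real) \<Rightarrow> real" where
  "Linf_norm S g = real_of_ereal (esssup (lebesgue_on S) (\<lambda>t. ereal \<bar>g t\<bar>))"

definition lagrange_basis :: "nat \<Rightarrow> (nat \<Rightarrow> real) \<Rightarrow> nat \<Rightarrow> real \<Rightarrow> real" where
  "lagrange_basis M \<tau> j x = (\<Prod>k\<in>{0..M} - {j}. (x - \<tau> k) / (\<tau> j - \<tau> k))"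

definition quad_weight :: "nat \<Rightarrow> (nat \<Rightarrow> real) \<Rightarrow> nat \<Rightarrow> nat \<Rightarrow> real" where
  "quad_weight M \<tau> m j = integral {0..\<tau> m} (lagrange_basis M \<tau> j)"

(* spidec_stage f M \<tau> h y k m is the m-th stage value after k correction sweeps of one step of
   size h started from y. *)
primrec spidec_stage :: "(real^'n \<Rightarrow> real^'n) \<Rightarrow> nat \<Rightarrow> (nat \<Rightarrow> real) \<Rightarrow> real \<Rightarrow> real^'n
    \<Rightarrow> nat \<Rightarrow> nat \<Rightarrow> real^'n" where
  "spidec_stage f M \<tau> h y 0 = (\<lambda>m. \<chi> i. y $ i * exp (h * \<tau> m * (f y $ i / y $ i)))"
| "spidec_stage f M \<tau> h y (Suc k) = (\<lambda>m. \<chi> i. y $ i * exp (h * (\<Sum>j=0..M. quad_weight M \<tau> m j *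
     (f (spidec_stage f M \<tau> h y k j) $ i / spidec_stage f M \<tau> h y k j $ i))))"

definition spidec_step :: "(real^'n \<Rightarrow> real^'n) \<Rightarrow> nat \<Rightarrow> nat \<Rightarrow> (nat \<Rightarrow> real) \<Rightarrow> real \<Rightarrow> real^'n
    \<Rightarrow> real^'n" where
  "spidec_step f M Nk \<tau> h y = spidec_stage f M \<tau> h y Nk M"

(* The local error at t_(n+1) = (n+1) h: one step applied to the exact value at t_n = n h. *)
definition spidec_local_error :: "(real^'n \<Rightarrow> real^'n) \<Rightarrow> nat \<Rightarrow> nat \<Rightarrow> (nat \<Rightarrow> real)
    \<Rightarrow> (real \<Rightarrow> real^'n) \<Rightarrow> real \<Rightarrow> nat \<Rightarrow> real^'n" where
  "spidec_local_error f M Nk \<tau> y h n =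
     y (real (Suc n) * h) - spidec_step f M Nk \<tau> h (y (real n * h))"

(* The method has order p of consistency along the solution y on [0,T]: there is one constant C,
   independent of n, bounding all local errors on the grids h = T / Nt with h small enough. *)
definition spidec_consistent :: "(real^'n \<Rightarrow> real^'n) \<Rightarrow> nat \<Rightarrow> nat \<Rightarrow> (nat \<Rightarrow> real)
    \<Rightarrow> (real \<Rightarrow> real^'n) \<Rightarrow> real \<Rightarrow> nat \<Rightarrow> bool" where
  "spidec_consistent f M Nk \<tau> y T p \<longleftrightarrow>
     (\<exists>C. \<exists>h0>0. \<forall>Nt\<ge>1. let h = T / real Nt in h \<le> h0 \<longrightarrow>
        (\<forall>n<Nt. (MAX i. \<bar>spidec_local_error f M Nk \<tau> y h n $ i\<bar>) \<le> C * h ^ (p + 1)))"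

end

theory Submission
  imports Defs "HOL-Computational_Algebra.Polynomial"
begin

text \<open>
  The scheme is spectral deferred correction applied to the logarithms of the components.  With
  \<open>g\<^sub>i(x) = f\<^sub>i(x) / x\<^sub>i\<close>, a positive solution satisfies \<open>(ln y\<^sub>i)' = g\<^sub>i(y)\<close>, and in each step the
  stage values have the form \<open>y\<^sub>i(a) exp(u)\<close>, where \<open>u\<close> approximates the exact increment
  \<open>ln y\<^sub>i(a + \<tau>\<^sub>m h) - ln y\<^sub>i(a)\<close>.  So errors are measured on these increments; since the exact
  solution is bounded, the exponential turns an error \<open>d \<le> 1/2\<close> of an increment into an error \<open>O(d)\<close>
  of the stage value (\<open>exponential_update_error\<close>).

  The increment error after \<open>k + 1\<close> sweeps splits into two parts.
  \<^item> The quadrature error on exact data.  The weights integrate polynomials of degree at most \<open>M\<close>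
    exactly, and \<open>t \<mapsto> g\<^sub>i(y t)\<close> has \<open>M + 1\<close> bounded derivatives on \<open>[0, T]\<close>
    (\<open>ln_solution_derivative\<close>), so Taylor expansion at the left end of the step gives
    \<open>O(h\<^bsup>M+2\<^esup>)\<close> (\<open>quadrature_step_error\<close>).
  \<^item> The error inherited from sweep \<open>k\<close>.  The ratio \<open>g\<close> is Lipschitz near the trajectory
    (\<open>ratio_lipschitz_near_compact\<close>) and the sum is multiplied by \<open>h\<close>, so one power of \<open>h\<close> is
    gained.

  The initial exponential Euler stages have increment error \<open>O(h\<^sup>2)\<close>.  By induction the stages
  after \<open>k\<close> sweeps have error \<open>O(h\<^bsup>min k M + 2\<^esup>)\<close> (\<open>spidec_stage_error\<close>).  The bound at
  \<open>k = Nk\<close> and \<open>\<tau>\<^sub>M = 1\<close> is the claim, because \<open>min Nk M + 2 = p + 1\<close>.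

  All constants depend only on bounds over \<open>[0, T]\<close> and over the compact set \<open>\<Omega>\<close>, and so do not depend
  on the step.  That the trajectory stays in the interior of \<open>\<Omega>\<close> follows from its lying in the box
  given by \<open>\<alpha>\<close> and \<open>\<beta>\<close> (\<open>trajectory_in_box\<close>).
\<close>

section \<open>Smoothness of the logarithms along the trajectory\<close>

text \<open>
  Derivatives are taken within \<open>S\<close>, hence one-sided at the end points of an interval: a solution on
  \<open>[0, T]\<close> has no others there, and Taylor's theorem on \<open>[0, T]\<close> uses no others.
\<close>

primrec Ck_within :: "nat \<Rightarrow> real set \<Rightarrow> (real \<Rightarrow> real) \<Rightarrow> bool" where
  "Ck_within 0 S u \<longleftrightarrow> continuous_on S u"
| "Ck_within (Suc k) S u \<longleftrightarrow>
     (\<exists>u'. (\<forall>t\<in>S. (u has_real_derivative u' t) (at t within S)) \<and> Ck_within k S u')"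

lemma Ck_within_SucI:
  assumes "\<And>t. t \<in> S \<Longrightarrow> (u has_real_derivative u' t) (at t within S)" and "Ck_within k S u'"
  shows "Ck_within (Suc k) S u"
  using assms by auto

lemma Ck_within_Suc_imp: "Ck_within (Suc k) S u \<Longrightarrow> Ck_within k S u"
proof (induction k arbitrary: u)
  case 0
  then show ?case by (auto intro: DERIV_continuous_on)
next
  case (Suc k)
  then obtain u' where "\<And>t. t \<in> S \<Longrightarrow> (u has_real_derivative u' t) (at t within S)"
    and "Ck_within (Suc k) S u'"
    by auto
  with Suc.IH show ?case by (blast intro: Ck_within_SucI)
qed

lemma Ck_within_mono: "Ck_within l S u \<Longrightarrow> k \<le> l \<Longrightarrow> Ck_within k S u"
  by (rule inc_induct[of k l "\<lambda>k. Ck_within k S u"]) (assumption | erule Ck_within_Suc_imp)+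

lemma Ck_within_const: "Ck_within k S (\<lambda>t. c)"
proof (induction k arbitrary: c)
  case (Suc k)
  show ?case by (rule Ck_within_SucI[where u' = "\<lambda>_. 0"]) (use Suc in auto)
qed auto

lemma Ck_within_add:
  "Ck_within k S u \<Longrightarrow> Ck_within k S v \<Longrightarrow> Ck_within k S (\<lambda>t. u t + v t)"
proof (induction k arbitrary: u v)
  case 0
  then show ?case by (simp add: continuous_on_add)
next
  case (Suc k)
  from Suc.prems obtain u' v'
    where "\<And>t. t \<in> S \<Longrightarrow> (u has_real_derivative u' t) (at t within S)" "Ck_within k S u'"
      and "\<And>t. t \<in> S \<Longrightarrow> (v has_real_derivative v' t) (at t within S)" "Ck_within k S v'"
    by auto
  then show ?case
    by (intro Ck_within_SucI[where u' = "\<lambda>t. u' t + v' t"] Suc.IH) (auto intro: DERIV_add)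
qed

lemma Ck_within_mult:
  "Ck_within k S u \<Longrightarrow> Ck_within k S v \<Longrightarrow> Ck_within k S (\<lambda>t. u t * v t)"
proof (induction k arbitrary: u v)
  case 0
  then show ?case by (simp add: continuous_on_mult)
next
  case (Suc k)
  from Suc.prems obtain u' v'
    where u': "\<And>t. t \<in> S \<Longrightarrow> (u has_real_derivative u' t) (at t within S)" "Ck_within k S u'"
      and v': "\<And>t. t \<in> S \<Longrightarrow> (v has_real_derivative v' t) (at t within S)" "Ck_within k S v'"
    by auto
  have "Ck_within k S (\<lambda>t. u' t * v t + v' t * u t)"
    using Suc.prems[THEN Ck_within_Suc_imp] u' v' by (intro Ck_within_add Suc.IH)
  then show ?case
    by (rule Ck_within_SucI[rotated]) (auto intro: DERIV_mult u' v')
qed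

lemma Ck_within_sum:
  "finite I \<Longrightarrow> (\<And>i. i \<in> I \<Longrightarrow> Ck_within k S (u i)) \<Longrightarrow> Ck_within k S (\<lambda>t. \<Sum>i\<in>I. u i t)"
  by (induction I rule: finite_induct) (simp_all add: Ck_within_const Ck_within_add)

lemma Ck_within_inverse:
  assumes nz: "\<And>t. t \<in> S \<Longrightarrow> u t \<noteq> 0"
  shows "Ck_within k S u \<Longrightarrow> Ck_within k S (\<lambda>t. inverse (u t))"
proof (induction k)
  case 0
  then show ?case by (simp add: continuous_on_inverse nz)
next
  case (Suc k)
  from Suc.prems obtain u'
    where u': "\<And>t. t \<in> S \<Longrightarrow> (u has_real_derivative u' t) (at t within S)" "Ck_within k S u'"
    by auto
  have inv: "Ck_within k S (\<lambda>t. inverse (u t))"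
    using Suc Ck_within_Suc_imp by blast
  have "Ck_within k S (\<lambda>t. (-1) * (inverse (u t) * u' t * inverse (u t)))"
    by (intro Ck_within_mult Ck_within_const inv u')
  then show ?case
    by (rule Ck_within_SucI[rotated]) (use u' nz in \<open>auto intro!: derivative_eq_intros\<close>)
qed

text \<open>
  The recursive definition suits closure properties, whereas Taylor's theorem asks for the whole list
  of derivatives as one function.
\<close>

lemma Ck_within_derivative_sequence:
  "Ck_within k S u \<Longrightarrow> \<exists>D. D 0 = u \<and> continuous_on S (D k) \<and>
     (\<forall>i<k. \<forall>t\<in>S. (D i has_real_derivative D (Suc i) t) (at t within S))"
proof (induction k arbitrary: u)
  case 0
  then show ?case by auto
next
  case (Suc k)
  from Suc.prems obtain u'
    where u': "\<And>t. t \<in> S \<Longrightarrow> (u has_real_derivative u' t) (at t within S)" "Ck_within k S u'"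
    by auto
  with Suc.IH obtain D where "D 0 = u'" "continuous_on S (D k)"
    "\<forall>i<k. \<forall>t\<in>S. (D i has_real_derivative D (Suc i) t) (at t within S)"
    by blast
  with u' show ?case
    by (intro exI[of _ "case_nat u D"]) (auto simp: less_Suc_eq_0_disj)
qed

lemma Ck_on_Suc_imp: "Ck_on (Suc k) S F \<Longrightarrow> Ck_on k S F"
proof (induction k arbitrary: F)
  case (Suc k)
  then obtain F' where "continuous_on S F" "\<forall>x\<in>interior S. (F has_derivative F' x) (at x)"
    "\<forall>v. Ck_on (Suc k) S (\<lambda>x. F' x v)"
    unfolding Ck_on.simps(2)[of "Suc k"] by blast
  with Suc.IH show ?case by auto
qed simp

lemma Ck_on_mono: "Ck_on l S F \<Longrightarrow> k \<le> l \<Longrightarrow> Ck_on k S F"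
  by (rule inc_induct[of k l "\<lambda>k. Ck_on k S F"]) (assumption | erule Ck_on_Suc_imp)+

lemma Ck_on_imp_continuous_on: "Ck_on k S F \<Longrightarrow> continuous_on S F"
  by (cases k) auto

text \<open>
  Smoothness of \<open>f\<close> is inherited by every \<open>C\<^sup>k\<close> observable along the trajectory: by the chain rule
  the time derivative of \<open>F\<^sub>i(y)\<close> is the sum over \<open>j\<close> of \<open>f\<^sub>j(y) \<partial>\<^sub>jF\<^sub>i(y)\<close>, whose factors are again
  observables, of class \<open>C\<^bsup>k-1\<^esup>\<close>.  The induction runs over all \<open>F\<close> at once so that it covers both
  factors.
\<close>

lemma Ck_within_along_solution:
  fixes f F :: "real^'n \<Rightarrow> real^'n" and y :: "real \<Rightarrow> real^'n"
  assumes sol: "\<And>t. t \<in> S \<Longrightarrow> (y has_vector_derivative f (y t)) (at t within S)"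
    and int: "\<And>t. t \<in> S \<Longrightarrow> y t \<in> interior \<Omega>"
    and f: "Ck_on q \<Omega> f"
  shows "k \<le> q \<Longrightarrow> Ck_on k \<Omega> F \<Longrightarrow> Ck_within k S (\<lambda>t. F (y t) $ i)"
proof (induction k arbitrary: F i)
  case 0
  have "continuous_on S y"
    using sol by (meson continuous_on_eq_continuous_within has_vector_derivative_continuous)
  moreover have "y ` S \<subseteq> \<Omega>"
    using int interior_subset by blast
  ultimately have "continuous_on S (\<lambda>t. F (y t))"
    using 0 by (auto intro: continuous_on_compose2)
  then show ?case
    by (simp add: continuous_on_component)
next
  case (Suc k)
  from Suc.prems obtain F'
    where F': "\<And>x. x \<in> interior \<Omega> \<Longrightarrow> (F has_derivative F' x) (at x)"
      and Ck: "\<And>v. Ck_on k \<Omega> (\<lambda>x. F' x v)"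
    by auto
  let ?d = "\<lambda>t. \<Sum>j\<in>UNIV. f (y t) $ j * F' (y t) (axis j 1) $ i"
  have "((\<lambda>t. F (y t) $ i) has_real_derivative ?d t) (at t within S)" if t: "t \<in> S" for t
  proof -
    have D: "(F has_derivative F' (y t)) (at (y t) within y ` S)"
      using F' int[OF t] has_derivative_at_withinI by blast
    then have lin: "linear (F' (y t))"
      using has_derivative_linear by blast
    have "((F \<circ> y) has_vector_derivative F' (y t) (f (y t))) (at t within S)"
      by (rule vector_derivative_diff_chain_within[OF sol[OF t] D])
    from bounded_linear.has_vector_derivative[OF bounded_linear_vec_nth this]
    have "((\<lambda>t. F (y t) $ i) has_real_derivative F' (y t) (f (y t)) $ i) (at t within S)"
      by (simp add: has_real_derivative_iff_has_vector_derivative)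
    moreover have "F' (y t) (f (y t)) $ i = ?d t"
      by (subst basis_expansion[of "f (y t)", symmetric])
         (simp add: linear_sum[OF lin] linear_cmul[OF lin] scalar_mult_eq_scaleR)
    ultimately show ?thesis by simp
  qed
  moreover have "Ck_within k S ?d"
    using Suc.prems Ck Ck_on_mono[OF f, of k]
    by (intro Ck_within_sum Ck_within_mult Suc.IH) auto
  ultimately show ?case by (rule Ck_within_SucI)
qed

text \<open>
  The logarithm of a component of the solution is an antiderivative of the quantity that the scheme
  integrates numerically.
\<close>

lemma ln_solution_derivative:
  fixes f :: "real^'n \<Rightarrow> real^'n" and y :: "real \<Rightarrow> real^'n"
  assumes sol: "\<And>t. t \<in> S \<Longrightarrow> (y has_vector_derivative f (y t)) (at t within S)"
    and int: "\<And>t. t \<in> S \<Longrightarrow> y t \<in> interior \<Omega>"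
    and f: "Ck_on q \<Omega> f"
    and pos: "\<And>t. t \<in> S \<Longrightarrow> 0 < y t $ i"
  shows "((\<And>t. t \<in> S \<Longrightarrow>
      ((\<lambda>t. ln (y t $ i)) has_real_derivative f (y t) $ i / y t $ i) (at t within S)))"
    and "Ck_within q S (\<lambda>t. f (y t) $ i / y t $ i)"
proof -
  have dy: "((\<lambda>t. y t $ i) has_real_derivative f (y t) $ i) (at t within S)" if "t \<in> S" for t
    using bounded_linear.has_vector_derivative[OF bounded_linear_vec_nth sol[OF that]]
    by (simp add: has_real_derivative_iff_has_vector_derivative)
  show "((\<lambda>t. ln (y t $ i)) has_real_derivative f (y t) $ i / y t $ i) (at t within S)"
    if "t \<in> S" for t
    using dy[OF that] pos[OF that] by (auto intro!: derivative_eq_intros)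
  have fy: "Ck_within q S (\<lambda>t. f (y t) $ i)"
    by (rule Ck_within_along_solution[OF sol int f order_refl f])
  have "Ck_within q S (\<lambda>t. y t $ i)"
    by (rule Ck_within_Suc_imp[OF Ck_within_SucI[OF dy fy]])
  then show "Ck_within q S (\<lambda>t. f (y t) $ i / y t $ i)"
    unfolding divide_inverse
    by (intro Ck_within_mult fy Ck_within_inverse) (use pos in force)
qed

section \<open>Quadrature error of the increments\<close>

text \<open>
  Both sides are polynomials in \<open>x\<close> of degree at most \<open>M\<close> that agree at the \<open>M + 1\<close> distinct nodes.
\<close>

lemma lagrange_basis_reproduces_power:
  assumes inj: "inj_on \<tau> {0..M}" and k: "k \<le> M"
  shows "(\<Sum>j=0..M. lagrange_basis M \<tau> j x * \<tau> j ^ k) = x ^ k"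
proof -
  define L where "L j = (\<Prod>l\<in>{0..M} - {j}. [:- \<tau> l / (\<tau> j - \<tau> l), 1 / (\<tau> j - \<tau> l):])" for j
  have L: "poly (L j) z = lagrange_basis M \<tau> j z" for j z
    by (simp add: L_def lagrange_basis_def poly_prod diff_divide_distrib)
  define P where "P = (\<Sum>j=0..M. smult (\<tau> j ^ k) (L j))"
  have node: "lagrange_basis M \<tau> j (\<tau> i) = (if i = j then 1 else 0)" if "i \<le> M" "j \<le> M" for i j
  proof (cases "i = j")
    case True
    have "\<tau> j - \<tau> l \<noteq> 0" if "l \<in> {0..M} - {j}" for l
      using inj_onD[OF inj, of j l] that \<open>j \<le> M\<close> by auto
    then show ?thesis using True by (simp add: lagrange_basis_def)
  next
    case False
    then show ?thesis using that by (auto simp: lagrange_basis_def intro!: bexI[of _ i])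
  qed
  have "degree (L j) \<le> M" if "j \<le> M" for j
  proof -
    have "degree (L j) \<le> (\<Sum>l\<in>{0..M} - {j}. 1)"
      unfolding L_def by (rule order_trans[OF degree_prod_sum_le])
         (simp, rule sum_mono, simp add: degree_pCons_eq_if)
    with that show ?thesis by simp
  qed
  then have "degree P \<le> M"
    unfolding P_def by (intro degree_sum_le) (auto intro: order_trans[OF degree_smult_le])
  moreover have "poly P z = poly (monom 1 k) z" if "z \<in> \<tau> ` {0..M}" for z
    using that by (auto simp: P_def poly_sum L node poly_monom if_distrib cong: if_cong)
  ultimately have "P = monom 1 k"
    using k card_image[OF inj]
    by (intro poly_eqI_degree[where A = "\<tau> ` {0..M}"]) (auto simp: degree_monom_eq)
  then have "poly P x = x ^ k"
    by (simp add: poly_monom)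
  then show ?thesis
    by (simp add: P_def poly_sum L mult.commute)
qed

lemma quad_weight_integrates_power:
  assumes inj: "inj_on \<tau> {0..M}" and k: "k \<le> M" and m: "0 \<le> \<tau> m"
  shows "(\<Sum>j=0..M. quad_weight M \<tau> m j * \<tau> j ^ k) = \<tau> m ^ Suc k / Suc k"
proof -
  have cont: "continuous_on S (lagrange_basis M \<tau> j)" for S j
    unfolding lagrange_basis_def divide_inverse by (intro continuous_intros)
  then have int: "lagrange_basis M \<tau> j integrable_on {0..\<tau> m}" for j
    by (rule integrable_continuous_interval)
  have "(\<Sum>j=0..M. quad_weight M \<tau> m j * \<tau> j ^ k)
      = integral {0..\<tau> m} (\<lambda>x. \<Sum>j=0..M. lagrange_basis M \<tau> j x * \<tau> j ^ k)"
    by (subst integral_sum) (auto simp: quad_weight_def intro!: integrable_on_mult_left int)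
  also have "\<dots> = integral {0..\<tau> m} (\<lambda>x. x ^ k)"
    by (simp only: lagrange_basis_reproduces_power[OF inj k])
  also have "\<dots> = \<tau> m ^ Suc k / Suc k"
  proof (rule integral_unique)
    have "((\<lambda>x. x ^ k) has_integral \<tau> m ^ Suc k / Suc k - 0 ^ Suc k / Suc k) {0..\<tau> m}"
      by (rule fundamental_theorem_of_calculus[OF m])
         (auto simp flip: has_real_derivative_iff_has_vector_derivative
            simp del: of_nat_Suc power_Suc intro!: derivative_eq_intros)
    then show "((\<lambda>x. x ^ k) has_integral \<tau> m ^ Suc k / Suc k) {0..\<tau> m}" by simp
  qed
  finally show ?thesis .
qed

lemma quad_weight_abs_sum_bound:
  obtains W where "0 \<le> W" and "\<And>m. m \<le> M \<Longrightarrow> (\<Sum>j=0..M. \<bar>quad_weight M \<tau> m j\<bar>) \<le> W"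
proof
  show "0 \<le> (\<Sum>m=0..M. \<Sum>j=0..M. \<bar>quad_weight M \<tau> m j\<bar>)"
    by (intro sum_nonneg) auto
  show "(\<Sum>j=0..M. \<bar>quad_weight M \<tau> m j\<bar>) \<le> (\<Sum>m=0..M. \<Sum>j=0..M. \<bar>quad_weight M \<tau> m j\<bar>)"
    if "m \<le> M" for m
    using that
    by (intro member_le_sum[of m "{0..M}" "\<lambda>m. \<Sum>j=0..M. \<bar>quad_weight M \<tau> m j\<bar>"]) (auto intro: sum_nonneg)
qed

text \<open>
  The factor \<open>1 / fact n\<close> of the remainder is dropped, since only the power of \<open>h\<close> matters below.
\<close>

lemma taylor_step:
  fixes D :: "nat \<Rightarrow> real \<Rightarrow> real"
  assumes D: "\<And>i t. i \<le> n \<Longrightarrow> t \<in> {0..T} \<Longrightarrow> (D i has_real_derivative D (Suc i) t) (at t within {0..T})"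
    and B: "\<And>t. t \<in> {0..T} \<Longrightarrow> \<bar>D (Suc n) t\<bar> \<le> B"
    and h: "0 < h" "0 \<le> a" "a + h \<le> T" and c: "0 \<le> c" "c \<le> 1"
  shows "\<bar>D 0 (a + c * h) - (\<Sum>i\<le>n. D i a * (c * h) ^ i / fact i)\<bar> \<le> B * h ^ Suc n"
proof -
  have ch: "0 \<le> c * h" "c * h \<le> h"
    using h c by (auto intro: mult_left_le_one_le)
  then have z: "a + c * h \<in> {0..T}"
    using h unfolding atLeastAtMost_iff by linarith
  have B0: "0 \<le> B" using B[OF z] by linarith
  have "\<bar>D 0 (a + c * h) - (\<Sum>i\<le>n. D i a * (c * h) ^ i / fact i)\<bar> \<le> B * (c * h) ^ Suc n / fact n"
    using field_Taylor[of "{0..T}" n D B a "a + c * h"] D B h z ch by (auto simp: abs_of_nonneg)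
  also have "\<dots> \<le> B * (c * h) ^ Suc n"
  proof -
    have "B * (c * h) ^ Suc n / fact n \<le> B * (c * h) ^ Suc n / 1"
      using B0 ch by (intro divide_left_mono) (auto simp: fact_ge_1 simp del: power_Suc)
    then show ?thesis by simp
  qed
  also have "\<dots> \<le> B * h ^ Suc n"
    using B0 ch by (intro mult_left_mono power_mono)
  finally show "\<bar>D 0 (a + c * h) - (\<Sum>i\<le>n. D i a * (c * h) ^ i / fact i)\<bar> \<le> B * h ^ Suc n" .
qed

text \<open>
  Here \<open>D 0\<close> is an antiderivative of the integrand \<open>D 1\<close>.  The weights reproduce the Taylor polynomial
  of the increment of \<open>D 0\<close> exactly from that of \<open>D 1\<close>, so only the two Taylor remainders are left:
  that of \<open>D 0\<close> is \<open>O(h\<^bsup>M+2\<^esup>)\<close>, and that of \<open>D 1\<close> is \<open>O(h\<^bsup>M+1\<^esup>)\<close> and enters with a factor \<open>h\<close>.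
\<close>

lemma quadrature_step_error:
  fixes D :: "nat \<Rightarrow> real \<Rightarrow> real"
  assumes D: "\<And>i t. i \<le> M + 1 \<Longrightarrow> t \<in> {0..T} \<Longrightarrow>
      (D i has_real_derivative D (Suc i) t) (at t within {0..T})"
    and B: "\<And>t. t \<in> {0..T} \<Longrightarrow> \<bar>D (M + 2) t\<bar> \<le> B"
    and inj: "inj_on \<tau> {0..M}" and \<tau>: "\<And>j. j \<le> M \<Longrightarrow> \<tau> j \<in> {0..1}"
    and h: "0 < h" "0 \<le> a" "a + h \<le> T" and m: "m \<le> M"
  shows "\<bar>D 0 (a + \<tau> m * h) - D 0 a - h * (\<Sum>j=0..M. quad_weight M \<tau> m j * D 1 (a + \<tau> j * h))\<bar>
    \<le> (1 + (\<Sum>j=0..M. \<bar>quad_weight M \<tau> m j\<bar>)) * B * h ^ (M + 2)"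
proof -
  define Q where "Q = quad_weight M \<tau> m"
  \<comment> \<open>\<open>P\<close> is the Taylor polynomial of \<open>D 1\<close> at \<open>a\<close> in the scaled variable \<open>c\<close>.\<close>
  define P where "P c = (\<Sum>i\<le>M. D (Suc i) a * (c * h) ^ i / fact i)" for c
  define R where "R c = D 1 (a + c * h) - P c" for c
  have R: "\<bar>R (\<tau> j)\<bar> \<le> B * h ^ Suc M" if "j \<le> M" for j
    using taylor_step[of M T "\<lambda>i. D (Suc i)" B h a "\<tau> j"] D B h \<tau>[OF that]
    by (simp add: R_def P_def)
  have exact: "h * (\<Sum>j=0..M. Q j * P (\<tau> j)) = (\<Sum>i\<le>M. D (Suc i) a * (\<tau> m * h) ^ Suc i / fact (Suc i))"
  proof -
    have "h * (\<Sum>j=0..M. Q j * P (\<tau> j))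
        = (\<Sum>j=0..M. \<Sum>i\<le>M. D (Suc i) a * h ^ Suc i / fact i * (Q j * \<tau> j ^ i))"
      by (simp add: P_def sum_distrib_left power_mult_distrib mult_ac)
    also have "\<dots> = (\<Sum>i\<le>M. \<Sum>j=0..M. D (Suc i) a * h ^ Suc i / fact i * (Q j * \<tau> j ^ i))"
      by (rule sum.swap)
    also have "\<dots> = (\<Sum>i\<le>M. D (Suc i) a * h ^ Suc i / fact i * (\<Sum>j=0..M. Q j * \<tau> j ^ i))"
      by (simp add: sum_distrib_left)
    also have "\<dots> = (\<Sum>i\<le>M. D (Suc i) a * h ^ Suc i / fact i * (\<tau> m ^ Suc i / Suc i))"
      unfolding Q_def using \<tau>[OF m]
      by (intro sum.cong refl arg_cong2[where f = "(*)"] quad_weight_integrates_power[OF inj]) auto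
    also have "\<dots> = (\<Sum>i\<le>M. D (Suc i) a * (\<tau> m * h) ^ Suc i / fact (Suc i))"
      by (simp add: power_mult_distrib mult_ac)
    finally show ?thesis .
  qed
  have "(\<Sum>i\<le>M + 1. D i a * (\<tau> m * h) ^ i / fact i) = D 0 a + h * (\<Sum>j=0..M. Q j * P (\<tau> j))"
    unfolding exact by (simp only: Suc_eq_plus1[symmetric] sum.atMost_Suc_shift) simp
  moreover have "h * (\<Sum>j=0..M. Q j * D 1 (a + \<tau> j * h))
      = h * (\<Sum>j=0..M. Q j * P (\<tau> j)) + h * (\<Sum>j=0..M. Q j * R (\<tau> j))"
    by (simp add: R_def algebra_simps sum_subtractf)
  ultimately have "\<bar>D 0 (a + \<tau> m * h) - D 0 a - h * (\<Sum>j=0..M. Q j * D 1 (a + \<tau> j * h))\<bar>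
      \<le> \<bar>D 0 (a + \<tau> m * h) - (\<Sum>i\<le>M + 1. D i a * (\<tau> m * h) ^ i / fact i)\<bar>
        + \<bar>h * (\<Sum>j=0..M. Q j * R (\<tau> j))\<bar>"
    by linarith
  also have "\<dots> \<le> B * h ^ (M + 2) + h * (\<Sum>j=0..M. \<bar>Q j\<bar> * (B * h ^ Suc M))"
  proof (rule add_mono)
    show "\<bar>D 0 (a + \<tau> m * h) - (\<Sum>i\<le>M + 1. D i a * (\<tau> m * h) ^ i / fact i)\<bar> \<le> B * h ^ (M + 2)"
      using taylor_step[of "M + 1" T D B h a "\<tau> m"] D B h \<tau>[OF m] by simp
    have "\<bar>\<Sum>j=0..M. Q j * R (\<tau> j)\<bar> \<le> (\<Sum>j=0..M. \<bar>Q j\<bar> * (B * h ^ Suc M))"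
      by (rule order_trans[OF sum_abs])
         (auto intro!: sum_mono mult_left_mono R simp: abs_mult simp del: power_Suc)
    then show "\<bar>h * (\<Sum>j=0..M. Q j * R (\<tau> j))\<bar> \<le> h * (\<Sum>j=0..M. \<bar>Q j\<bar> * (B * h ^ Suc M))"
      using h by (simp add: abs_mult)
  qed
  also have "\<dots> = (1 + (\<Sum>j=0..M. \<bar>Q j\<bar>)) * B * h ^ (M + 2)"
    by (simp add: algebra_simps flip: sum_distrib_left sum_distrib_right)
  finally show ?thesis by (simp add: Q_def)
qed

text \<open>
  One constant serves the exponential Euler predictor (first bound) and the collocation quadrature
  (second bound) at every step position \<open>a\<close>, because the derivatives are bounded on all of \<open>[0, T]\<close>.
\<close>

lemma increment_error_bounds:
  assumes u: "\<And>t. t \<in> {0..T} \<Longrightarrow> (u has_real_derivative g t) (at t within {0..T})"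
    and g: "Ck_within (M + 1) {0..T} g"
    and inj: "inj_on \<tau> {0..M}" and \<tau>: "\<And>j. j \<le> M \<Longrightarrow> \<tau> j \<in> {0..1}"
  shows "\<exists>A\<ge>0. \<forall>a h m. 0 < h \<longrightarrow> 0 \<le> a \<longrightarrow> a + h \<le> T \<longrightarrow> m \<le> M \<longrightarrow>
    \<bar>u (a + \<tau> m * h) - u a - h * \<tau> m * g a\<bar> \<le> A * h\<^sup>2 \<and>
    \<bar>u (a + \<tau> m * h) - u a - h * (\<Sum>j=0..M. quad_weight M \<tau> m j * g (a + \<tau> j * h))\<bar> \<le> A * h ^ (M + 2)"
proof -
  obtain E where E: "E 0 = g" "continuous_on {0..T} (E (M + 1))"
    and dE: "\<And>i t. i < M + 1 \<Longrightarrow> t \<in> {0..T} \<Longrightarrow> (E i has_real_derivative E (Suc i) t) (at t within {0..T})"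
    using Ck_within_derivative_sequence[OF g] by blast
  define D where "D = case_nat u E"
  have D: "(D i has_real_derivative D (Suc i) t) (at t within {0..T})" if "i \<le> M + 1" "t \<in> {0..T}" for i t
    using that u E dE by (cases i) (auto simp: D_def)
  have "continuous_on {0..T} (D i)" if "i \<le> M + 2" for i
    using that E(2) D DERIV_continuous_on[of "{0..T}" "D i" "D (Suc i)"]
    by (cases "i = M + 2") (auto simp: D_def)
  then have "\<exists>B. \<forall>t\<in>{0..T}. \<bar>D i t\<bar> \<le> B" if "i \<le> M + 2" for i
    using compact_imp_bounded[OF compact_continuous_image[OF _ compact_Icc]] that
    by (fastforce simp: bounded_iff)
  then obtain B2 BM where B: "\<And>t. t \<in> {0..T} \<Longrightarrow> \<bar>D 2 t\<bar> \<le> B2"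
    "\<And>t. t \<in> {0..T} \<Longrightarrow> \<bar>D (M + 2) t\<bar> \<le> BM"
    by (metis le_add2 order_refl)
  obtain W where W: "0 \<le> W" "\<And>m. m \<le> M \<Longrightarrow> (\<Sum>j=0..M. \<bar>quad_weight M \<tau> m j\<bar>) \<le> W"
    using quad_weight_abs_sum_bound[of M \<tau>] by blast
  define A where "A = \<bar>B2\<bar> + (1 + W) * \<bar>BM\<bar>"
  have A: "B2 \<le> A" "(1 + W) * \<bar>BM\<bar> \<le> A"
    using W by (auto simp: A_def intro: order_trans[OF abs_ge_self])
  show ?thesis
  proof (intro exI[of _ A] conjI allI impI)
    show "0 \<le> A" using W by (auto simp: A_def)
    fix a h m
    assume h: "0 < h" "0 \<le> a" "a + h \<le> T" and m: "m \<le> M"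
    have "\<bar>D 0 (a + \<tau> m * h) - (\<Sum>i\<le>1. D i a * (\<tau> m * h) ^ i / fact i)\<bar> \<le> B2 * h ^ Suc 1"
      using taylor_step[of 1 T D B2 h a "\<tau> m"] D B h \<tau>[OF m] by (simp add: numeral_2_eq_2)
    also have "\<dots> \<le> A * h ^ Suc 1" using A h by (intro mult_right_mono) auto
    finally show "\<bar>u (a + \<tau> m * h) - u a - h * \<tau> m * g a\<bar> \<le> A * h\<^sup>2"
      by (simp add: D_def E numeral_2_eq_2 algebra_simps)
    have "\<bar>D 0 (a + \<tau> m * h) - D 0 a - h * (\<Sum>j=0..M. quad_weight M \<tau> m j * D 1 (a + \<tau> j * h))\<bar>
        \<le> (1 + (\<Sum>j=0..M. \<bar>quad_weight M \<tau> m j\<bar>)) * BM * h ^ (M + 2)"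
      by (rule quadrature_step_error[OF D B(2) inj \<tau> h m])
    also have "\<dots> \<le> A * h ^ (M + 2)"
    proof (intro mult_right_mono)
      have "0 \<le> BM" using B(2)[of a] h by force
      then have "(1 + (\<Sum>j=0..M. \<bar>quad_weight M \<tau> m j\<bar>)) * BM \<le> (1 + W) * \<bar>BM\<bar>"
        using W m by (intro mult_mono) auto
      with A show "(1 + (\<Sum>j=0..M. \<bar>quad_weight M \<tau> m j\<bar>)) * BM \<le> A" by linarith
    qed (use h in auto)
    finally show "\<bar>u (a + \<tau> m * h) - u a
        - h * (\<Sum>j=0..M. quad_weight M \<tau> m j * g (a + \<tau> j * h))\<bar> \<le> A * h ^ (M + 2)"
      by (simp add: D_def E)
  qed
qed

section \<open>Position of the trajectory\<close>

text \<open>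
  A continuous function is bounded everywhere by its essential supremum: the set where the bound holds
  is closed and has full measure in the open interval, hence contains it and its closure.
\<close>

lemma abs_le_Linf_norm:
  assumes T: "0 < T" and g: "continuous_on {0..T} g" and t: "t \<in> {0..T}"
  shows "\<bar>g t\<bar> \<le> Linf_norm {0..T} g"
proof -
  define E where "E = esssup (lebesgue_on {0..T}) (\<lambda>t. ereal \<bar>g t\<bar>)"
  have abs_g: "continuous_on {0..T} (\<lambda>t. \<bar>g t\<bar>)"
    using g by (intro continuous_intros)
  then have cont: "continuous_on {0..T} (\<lambda>t. ereal \<bar>g t\<bar>)"
    by (intro continuous_on_ereal)
  have meas: "(\<lambda>t. ereal \<bar>g t\<bar>) \<in> borel_measurable (lebesgue_on {0..T})"
    using abs_g by (intro borel_measurable_ereal continuous_imp_measurable_on_sets_lebesgue) auto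
  obtain B where B: "\<And>t. t \<in> {0..T} \<Longrightarrow> \<bar>g t\<bar> \<le> B"
    using compact_imp_bounded[OF compact_continuous_image[OF g compact_Icc]]
    unfolding bounded_iff by (metis image_eqI real_norm_def)
  have "E \<le> ereal B"
    unfolding E_def using meas B by (intro esssup_I) (auto intro!: AE_I2)
  define C where "C = {0..T} \<inter> (\<lambda>t. ereal \<bar>g t\<bar>) -` {..E}"
  have "closed C"
    unfolding C_def using cont by (intro continuous_closed_preimage) auto
  have "AE t in lebesgue_on {0..T}. ereal \<bar>g t\<bar> \<le> E"
    unfolding E_def by (rule esssup_AE)
  then have "AE t\<in>{0<..<T} in lebesgue. t \<in> C"
    by (subst (asm) AE_restrict_space_iff) (auto simp: C_def elim!: eventually_mono)
  then have "{0<..<T} \<subseteq> C"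
    using mem_closed_if_AE_lebesgue_open[OF open_greaterThanLessThan \<open>closed C\<close>] by blast
  then have "closure {0<..<T} \<subseteq> C"
    using \<open>closed C\<close> by (rule closure_minimal)
  then have "ereal \<bar>g t\<bar> \<le> E"
    using t T by (auto simp: C_def)
  \<comment> \<open>\<open>Linf_norm\<close> maps an infinite supremum to \<open>0\<close>, hence the need for the bound \<open>B\<close>.\<close>
  with \<open>E \<le> ereal B\<close> show ?thesis
    unfolding Linf_norm_def E_def[symmetric] by (cases E) auto
qed

text \<open>
  The infimum \<open>\<alpha>\<close> is positive because each component attains its minimum on \<open>[0, T]\<close> and there are
  finitely many components.
\<close>

lemma trajectory_in_box:
  fixes y :: "real \<Rightarrow> real^'n"
  assumes T: "0 < T" and y: "continuous_on {0..T} y"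
    and pos: "\<And>t i. t \<in> {0..T} \<Longrightarrow> 0 < y t $ i"
    and \<alpha>: "\<alpha> = (INF (i, t)\<in>UNIV \<times> {0..T}. \<bar>y t $ i\<bar>)"
    and \<beta>: "\<beta> = (MAX i. Linf_norm {0..T} (\<lambda>t. y t $ i))"
  shows "0 < \<alpha>" and "\<And>t i. t \<in> {0..T} \<Longrightarrow> \<alpha> \<le> y t $ i" and "\<And>t i. t \<in> {0..T} \<Longrightarrow> y t $ i \<le> \<beta>"
proof -
  have cont: "continuous_on {0..T} (\<lambda>t. y t $ i)" for i
    using y by (rule continuous_on_component)
  have "\<exists>c>0. \<forall>t\<in>{0..T}. c \<le> y t $ i" for i
    using continuous_attains_inf[OF compact_Icc _ cont, of i] T pos by fastforce
  then obtain c where c: "\<And>i. 0 < c i" "\<And>i t. t \<in> {0..T} \<Longrightarrow> c i \<le> y t $ i"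
    by metis
  have "0 < Min (range c)" using c by simp
  also have "Min (range c) \<le> \<alpha>"
    unfolding \<alpha>
  proof (rule cINF_greatest)
    show "UNIV \<times> {0..T} \<noteq> ({} :: ('n \<times> real) set)" using T by auto
    fix p :: "'n \<times> real" assume p: "p \<in> UNIV \<times> {0..T}"
    obtain i t where [simp]: "p = (i, t)" by (cases p)
    have "Min (range c) \<le> c i" by simp
    also have "c i \<le> y t $ i" using p c by simp
    finally show "Min (range c) \<le> (case p of (i, t) \<Rightarrow> \<bar>y t $ i\<bar>)" by simp
  qed
  finally show "0 < \<alpha>" .
  show "\<alpha> \<le> y t $ i" if "t \<in> {0..T}" for t i
  proof -
    have "bdd_below ((\<lambda>(i, t). \<bar>y t $ i\<bar>) ` (UNIV \<times> {0..T}))"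
      by (rule bdd_belowI[of _ 0]) auto
    then have "\<alpha> \<le> (case (i, t) of (i, t) \<Rightarrow> \<bar>y t $ i\<bar>)"
      unfolding \<alpha> using that by (intro cINF_lower) auto
    then show ?thesis using pos[OF that, of i] by simp
  qed
  show "y t $ i \<le> \<beta>" if "t \<in> {0..T}" for t i
  proof -
    have "y t $ i \<le> Linf_norm {0..T} (\<lambda>t. y t $ i)"
      using abs_le_Linf_norm[OF T cont that, of i] by simp
    also have "\<dots> \<le> \<beta>" unfolding \<beta> by (intro Max_ge) auto
    finally show ?thesis .
  qed
qed

section \<open>Lipschitz estimate for the ratios\<close>

text \<open>
  Stage values lie off the trajectory, so the Lipschitz estimate has to hold on balls of a fixed
  radius around it.  These balls are convex subsets of the interior of \<open>\<Omega>\<close>, and compactness of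
  \<open>\<Omega>\<close> bounds \<open>f\<close>, its derivative and the reciprocals of the coordinates on all of them at once.
\<close>

lemma ratio_lipschitz_near_compact:
  fixes f :: "real^'n \<Rightarrow> real^'n"
  assumes \<Omega>: "compact \<Omega>" "\<Omega> \<subseteq> pos_orthant" and f: "Ck_on (Suc k) \<Omega> f"
    and K: "compact K" "K \<subseteq> interior \<Omega>"
  obtains e L where "0 < e" and "0 \<le> L"
    and "\<And>x z i. x \<in> K \<Longrightarrow> norm (z - x) \<le> e \<Longrightarrow>
      \<bar>f z $ i / z $ i - f x $ i / x $ i\<bar> \<le> L * norm (z - x)"
proof -
  have bound: "\<exists>B. \<forall>x\<in>\<Omega>. norm (F x) \<le> B" if "continuous_on \<Omega> F" for F :: "real^'n \<Rightarrow> real^'n"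
    using compact_imp_bounded[OF compact_continuous_image[OF that \<Omega>(1)]]
    by (auto simp: bounded_iff)
  from f obtain f' where f': "\<And>x. x \<in> interior \<Omega> \<Longrightarrow> (f has_derivative f' x) (at x)"
    and Ck: "\<And>v. Ck_on k \<Omega> (\<lambda>x. f' x v)" and cont: "continuous_on \<Omega> f"
    by auto
  have "\<exists>B. \<forall>x\<in>\<Omega>. norm (f' x v) \<le> B" for v
    by (rule bound[OF Ck_on_imp_continuous_on[OF Ck]])
  then obtain b where b: "\<And>v x. x \<in> \<Omega> \<Longrightarrow> norm (f' x v) \<le> b v"
    by metis
  obtain F where F: "\<And>x. x \<in> \<Omega> \<Longrightarrow> norm (f x) \<le> F"
    using bound[OF cont] by auto
  have pos: "0 < x $ i" if "x \<in> \<Omega>" for x i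
    using \<Omega>(2) that by (auto simp: pos_orthant_def)
  have "continuous_on \<Omega> (\<lambda>x. \<chi> i. inverse (x $ i))"
    using pos by (intro continuous_intros) (auto simp: less_imp_neq[THEN not_sym])
  from bound[OF this] obtain G where "\<And>x. x \<in> \<Omega> \<Longrightarrow> norm (\<chi> i. inverse (x $ i)) \<le> G"
    by auto
  then have G: "\<bar>inverse (x $ i)\<bar> \<le> G" if "x \<in> \<Omega>" for x i
    using component_le_norm_cart[of "\<chi> i. inverse (x $ i)" i] that by fastforce
  define B where "B = \<bar>\<Sum>v\<in>Basis. b v\<bar>"
  have onorm: "onorm (f' x) \<le> B" if x: "x \<in> interior \<Omega>" for x
  proof -
    have "onorm (f' x) \<le> (\<Sum>v\<in>Basis. norm (f' x v))"
      using f'[OF x] has_derivative_bounded_linear onorm_componentwise by blast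
    also have "\<dots> \<le> (\<Sum>v\<in>Basis. b v)"
      using x interior_subset by (intro sum_mono b) auto
    finally show ?thesis by (simp add: B_def)
  qed
  obtain e where e: "0 < e" "(\<Union>x\<in>K. cball x e) \<subseteq> interior \<Omega>"
    using compact_subset_open_imp_cball_epsilon_subset[OF K(1) open_interior K(2)] by metis
  show thesis
  proof
    show "0 < e" by (rule e)
    show "0 \<le> \<bar>B * G + F * G * G\<bar>" by simp
    fix x z :: "real^'n" and i
    assume x: "x \<in> K" and z: "norm (z - x) \<le> e"
    have ball: "cball x (e) \<subseteq> interior \<Omega>"
      using e x by (force simp: subset_iff)
    then have fL: "norm (f z - f x) \<le> B * norm (z - x)"
      using f' onorm z e
      by (intro differentiable_bound[of "cball x (e)" f f'])
         (auto simp: dist_norm norm_minus_commute subset_iff intro: has_derivative_at_withinI)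
    have \<Omega>x: "x \<in> \<Omega>" and \<Omega>z: "z \<in> \<Omega>"
      using ball z e interior_subset[of \<Omega>] by (auto simp: subset_iff dist_norm norm_minus_commute)
    have B0: "0 \<le> B" by (simp add: B_def)
    have F0: "0 \<le> F" using F[OF \<Omega>x] norm_ge_zero order_trans by blast
    have G0: "0 \<le> G" using G[OF \<Omega>x, of i] by linarith
    have fi: "\<bar>f z $ i - f x $ i\<bar> \<le> B * norm (z - x)"
      using component_le_norm_cart[of "f z - f x" i] fL by simp
    have zi: "\<bar>x $ i - z $ i\<bar> \<le> norm (z - x)"
      using component_le_norm_cart[of "z - x" i] by simp
    have fx: "\<bar>f x $ i\<bar> \<le> F"
      using component_le_norm_cart[of "f x" i] F[OF \<Omega>x] by simp
    have "f z $ i / z $ i - f x $ i / x $ i =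
        (f z $ i - f x $ i) * inverse (z $ i)
          + f x $ i * (x $ i - z $ i) * inverse (z $ i) * inverse (x $ i)"
      using pos[OF \<Omega>x, of i] pos[OF \<Omega>z, of i] by (simp add: field_simps)
    also have "\<bar>\<dots>\<bar> \<le> \<bar>f z $ i - f x $ i\<bar> * \<bar>inverse (z $ i)\<bar>
        + \<bar>f x $ i\<bar> * \<bar>x $ i - z $ i\<bar> * \<bar>inverse (z $ i)\<bar> * \<bar>inverse (x $ i)\<bar>"
      by (rule order_trans[OF abs_triangle_ineq]) (simp only: abs_mult order_refl)
    also have "\<dots> \<le> B * norm (z - x) * G + F * norm (z - x) * G * G"
      using B0 F0 G0 by (intro add_mono mult_mono fi zi fx G \<Omega>x \<Omega>z) auto
    also have "\<dots> = (B * G + F * G * G) * norm (z - x)"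
      by (simp add: algebra_simps)
    also have "\<dots> \<le> \<bar>B * G + F * G * G\<bar> * norm (z - x)"
      by (intro mult_right_mono) auto
    finally show "\<bar>f z $ i / z $ i - f x $ i / x $ i\<bar> \<le> \<bar>B * G + F * G * G\<bar> * norm (z - x)" .
  qed
qed

section \<open>Error propagation through the sweeps\<close>

lemma abs_exp_minus_one_le:
  fixes d :: real
  assumes "\<bar>d\<bar> \<le> 1 / 2"
  shows "\<bar>exp d - 1\<bar> \<le> 2 * \<bar>d\<bar>"
proof -
  have "exp d \<le> 1 + 2 * \<bar>d\<bar>"
    using exp_bound_lemma[of d] assms by simp
  moreover have "1 + d \<le> exp d"
    by (rule exp_ge_add_one_self)
  ultimately show ?thesis by linarith
qed

text \<open>
  Writing \<open>x\<^sub>i exp(u\<^sub>i) = x'\<^sub>i exp(r)\<close> with \<open>r\<close> the error of the logarithmic increment reduces the claim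
  to \<open>\<bar>exp r - 1\<bar> \<le> 2 \<bar>r\<bar>\<close>.
\<close>

lemma exponential_update_error:
  fixes x x' :: "real^'n"
  assumes pos: "\<And>i. 0 < x $ i" "\<And>i. 0 < x' $ i" and Y: "\<And>i. x' $ i \<le> Y"
    and u: "\<And>i. \<bar>ln (x' $ i) - ln (x $ i) - u i\<bar> \<le> d" and d: "d \<le> 1 / 2"
  shows "norm ((\<chi> i. x $ i * exp (u i)) - x') \<le> 2 * real CARD('n) * Y * d"
proof -
  have "\<bar>x $ i * exp (u i) - x' $ i\<bar> \<le> Y * (2 * d)" for i
  proof -
    let ?r = "u i - (ln (x' $ i) - ln (x $ i))"
    have r: "\<bar>?r\<bar> \<le> d" using u[of i] by linarith
    have exp_r: "exp ?r = x $ i * exp (u i) / x' $ i"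
      using pos by (simp add: exp_diff)
    have "x $ i * exp (u i) - x' $ i = x' $ i * (exp ?r - 1)"
      using pos(2)[of i] by (simp add: exp_r right_diff_distrib)
    then have "\<bar>x $ i * exp (u i) - x' $ i\<bar> = x' $ i * \<bar>exp ?r - 1\<bar>"
      using pos by (simp add: abs_mult less_imp_le)
    also have "\<dots> \<le> Y * (2 * d)"
      using abs_exp_minus_one_le[of ?r] r d Y[of i] pos(2)[of i] by (intro mult_mono) auto
    finally show ?thesis .
  qed
  then have "(\<Sum>i\<in>UNIV. \<bar>((\<chi> i. x $ i * exp (u i)) - x') $ i\<bar>) \<le> (\<Sum>i\<in>(UNIV::'n set). Y * (2 * d))"
    by (intro sum_mono) simp
  then show ?thesis
    using norm_le_l1_cart[of "(\<chi> i. x $ i * exp (u i)) - x'"] by (simp add: mult_ac)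
qed

text \<open>
  Every sweep gains one power of \<open>h\<close> until the quadrature error, of order \<open>M + 2\<close>, dominates.  The step
  size bound shrinks with each sweep: the previous stages must lie within the distance \<open>e\<close> of the
  trajectory, where the Lipschitz estimate applies, and the increment error must be at most \<open>1/2\<close>.
\<close>

lemma spidec_stage_error:
  fixes f :: "real^'n \<Rightarrow> real^'n" and y :: "real \<Rightarrow> real^'n"
  assumes pos: "\<And>t i. t \<in> {0..T} \<Longrightarrow> 0 < y t $ i"
    and Y: "\<And>t i. t \<in> {0..T} \<Longrightarrow> y t $ i \<le> Y"
    and \<tau>: "\<And>j. j \<le> M \<Longrightarrow> \<tau> j \<in> {0..1}"
    and lip: "0 < e" "0 \<le> L" "\<And>t z i. t \<in> {0..T} \<Longrightarrow> norm (z - y t) \<le> e \<Longrightarrow>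
      \<bar>f z $ i / z $ i - f (y t) $ i / y t $ i\<bar> \<le> L * norm (z - y t)"
    and A: "0 \<le> A"
    and euler: "\<And>a h m i. 0 < h \<Longrightarrow> 0 \<le> a \<Longrightarrow> a + h \<le> T \<Longrightarrow> m \<le> M \<Longrightarrow>
      \<bar>ln (y (a + \<tau> m * h) $ i) - ln (y a $ i) - h * \<tau> m * (f (y a) $ i / y a $ i)\<bar> \<le> A * h\<^sup>2"
    and quad: "\<And>a h m i. 0 < h \<Longrightarrow> 0 \<le> a \<Longrightarrow> a + h \<le> T \<Longrightarrow> m \<le> M \<Longrightarrow>
      \<bar>ln (y (a + \<tau> m * h) $ i) - ln (y a $ i) - h * (\<Sum>j=0..M. quad_weight M \<tau> m j *
         (f (y (a + \<tau> j * h)) $ i / y (a + \<tau> j * h) $ i))\<bar> \<le> A * h ^ (M + 2)"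
  shows "\<exists>C\<ge>0. \<exists>h0>0. \<forall>h a m. 0 < h \<longrightarrow> h \<le> h0 \<longrightarrow> 0 \<le> a \<longrightarrow> a + h \<le> T \<longrightarrow> m \<le> M \<longrightarrow>
    norm (spidec_stage f M \<tau> h (y a) k m - y (a + \<tau> m * h)) \<le> C * h ^ (min k M + 2)"
proof -
  have t: "a \<in> {0..T}" "a + \<tau> j * h \<in> {0..T}" if "0 < h" "0 \<le> a" "a + h \<le> T" "j \<le> M" for a h :: real and j
  proof -
    have "0 \<le> \<tau> j * h" "\<tau> j * h \<le> h"
      using \<tau>[OF \<open>j \<le> M\<close>] \<open>0 < h\<close> by (auto intro: mult_left_le_one_le)
    then show "a \<in> {0..T}" "a + \<tau> j * h \<in> {0..T}"
      using that unfolding atLeastAtMost_iff by linarith+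
  qed
  have small: "\<exists>h0>0. h0 \<le> 1 \<and> (\<forall>h>0. h \<le> h0 \<longrightarrow> c * h ^ (r + 2) \<le> d)"
    if "0 \<le> c" "0 < d" for c d :: real and r :: nat
    \<comment> \<open>The summand \<open>1\<close> in the denominator covers the case \<open>c = 0\<close>.\<close>
  proof (intro exI[of _ "min 1 (d / (c + 1))"] conjI allI impI)
    fix h :: real assume h: "0 < h" "h \<le> min 1 (d / (c + 1))"
    have "h ^ (r + 2) \<le> h ^ 1" using h by (intro power_decreasing) auto
    then have "c * h ^ (r + 2) \<le> c * h" using that by (intro mult_left_mono) auto
    also have "\<dots> \<le> (c + 1) * h" using h by simp
    also have "\<dots> \<le> d" using h that by (simp add: field_simps)
    finally show "c * h ^ (r + 2) \<le> d" .
  qed (use that in auto)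
  have update: "norm ((\<chi> i. y a $ i * exp (u i)) - y (a + \<tau> m * h)) \<le> 2 * real CARD('n) * \<bar>Y\<bar> * (c * h ^ (r + 2))"
    if "0 < h" "0 \<le> a" "a + h \<le> T" "m \<le> M" "c * h ^ (r + 2) \<le> 1 / 2"
      "\<And>i. \<bar>ln (y (a + \<tau> m * h) $ i) - ln (y a $ i) - u i\<bar> \<le> c * h ^ (r + 2)"
    for a h c :: real and m r :: nat and u :: "'n \<Rightarrow> real"
    using that t[OF that(1-4)] pos Y
    by (intro exponential_update_error) (auto intro: order_trans[OF _ abs_ge_self])
  show ?thesis
  proof (induction k)
    case 0
    obtain h0 where h0: "0 < h0" "\<And>h. 0 < h \<Longrightarrow> h \<le> h0 \<Longrightarrow> A * h ^ (0 + 2) \<le> 1 / 2"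
      using small[of A "1 / 2" 0] A by auto
    show ?case
    proof (rule exI[of _ "2 * real CARD('n) * \<bar>Y\<bar> * A"], intro conjI exI[of _ h0] allI impI)
      fix h a :: real and m
      assume h: "0 < h" "h \<le> h0" "0 \<le> a" "a + h \<le> T" "m \<le> M"
      have "norm ((\<chi> i. y a $ i * exp (h * \<tau> m * (f (y a) $ i / y a $ i))) - y (a + \<tau> m * h))
          \<le> 2 * real CARD('n) * \<bar>Y\<bar> * (A * h ^ (0 + 2))"
        using euler[OF h(1,3-5)] by (intro update[OF h(1,3-5) h0(2)[OF h(1,2)]]) (simp add: power2_eq_square)
      then show "norm (spidec_stage f M \<tau> h (y a) 0 m - y (a + \<tau> m * h))
          \<le> 2 * real CARD('n) * \<bar>Y\<bar> * A * h ^ (min 0 M + 2)"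
        by (simp add: mult.assoc)
    qed (use A h0 in auto)
  next
    case (Suc k)
    then obtain C h1 where C: "0 \<le> C" and h1: "0 < h1" and
      IH: "\<And>h a m. 0 < h \<Longrightarrow> h \<le> h1 \<Longrightarrow> 0 \<le> a \<Longrightarrow> a + h \<le> T \<Longrightarrow> m \<le> M \<Longrightarrow>
        norm (spidec_stage f M \<tau> h (y a) k m - y (a + \<tau> m * h)) \<le> C * h ^ (min k M + 2)"
      by blast
    obtain W where W0: "0 \<le> W"
      and W: "\<And>m. m \<le> M \<Longrightarrow> (\<Sum>j=0..M. \<bar>quad_weight M \<tau> m j\<bar>) \<le> W"
      using quad_weight_abs_sum_bound[of M \<tau>] by blast
    define A' where "A' = A + W * L * C"
    have A': "0 \<le> A'" using A W0 C lip(2) by (simp add: A'_def)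
    obtain h2 where h2: "0 < h2" "h2 \<le> 1"
      "\<And>h. 0 < h \<Longrightarrow> h \<le> h2 \<Longrightarrow> C * h ^ (min k M + 2) \<le> e"
      using small[OF C lip(1), of "min k M"] by auto
    obtain h3 where h3: "0 < h3"
      "\<And>h. 0 < h \<Longrightarrow> h \<le> h3 \<Longrightarrow> A' * h ^ (min (Suc k) M + 2) \<le> 1 / 2"
      using small[OF A', of "1 / 2" "min (Suc k) M"] by auto
    show ?case
    proof (rule exI[of _ "2 * real CARD('n) * \<bar>Y\<bar> * A'"], intro conjI exI[of _ "min h1 (min h2 h3)"] allI impI)
      fix h a :: real and m
      assume "0 < h" "h \<le> min h1 (min h2 h3)" "0 \<le> a" "a + h \<le> T" and m: "m \<le> M"
      then have h: "0 < h" "0 \<le> a" "a + h \<le> T" "h \<le> h1" "h \<le> h2" "h \<le> h3" "h \<le> 1"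
        using h2(2) by auto
      \<comment> \<open>\<open>u\<close> is the logarithmic increment that the scheme computes from the previous stages \<open>w\<close>.\<close>
      define w where "w = spidec_stage f M \<tau> h (y a) k"
      define g where "g x i = f x $ i / x $ i" for x :: "real^'n" and i
      define u where "u i = h * (\<Sum>j=0..M. quad_weight M \<tau> m j * g (w j) i)" for i
      have ln_error: "\<bar>ln (y (a + \<tau> m * h) $ i) - ln (y a $ i) - u i\<bar> \<le> A' * h ^ (min (Suc k) M + 2)" for i
      proof -
        have stage: "\<bar>g (w j) i - g (y (a + \<tau> j * h)) i\<bar> \<le> L * (C * h ^ (min k M + 2))" if j: "j \<le> M" for j
        proof -
          have n: "norm (w j - y (a + \<tau> j * h)) \<le> C * h ^ (min k M + 2)"
            unfolding w_def using h j by (intro IH)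
          then have "norm (w j - y (a + \<tau> j * h)) \<le> e"
            using h2(3)[OF h(1,5)] by linarith
          from lip(3)[OF t(2)[OF h(1-3) j] this]
          have "\<bar>g (w j) i - g (y (a + \<tau> j * h)) i\<bar> \<le> L * norm (w j - y (a + \<tau> j * h))"
            by (simp add: g_def)
          with mult_left_mono[OF n lip(2)] show ?thesis by linarith
        qed
        have "\<bar>\<Sum>j=0..M. quad_weight M \<tau> m j * (g (y (a + \<tau> j * h)) i - g (w j) i)\<bar>
            \<le> (\<Sum>j=0..M. \<bar>quad_weight M \<tau> m j\<bar> * (L * (C * h ^ (min k M + 2))))"
          using stage by (intro order_trans[OF sum_abs] sum_mono)
             (auto simp: abs_mult abs_minus_commute simp del: power_Suc intro!: mult_left_mono)
        also have "\<dots> \<le> W * (L * (C * h ^ (min k M + 2)))"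
          unfolding sum_distrib_right[symmetric] using W[OF m] lip(2) C h
          by (intro mult_right_mono) auto
        finally have propagated: "\<bar>h * (\<Sum>j=0..M. quad_weight M \<tau> m j * (g (y (a + \<tau> j * h)) i - g (w j) i))\<bar>
            \<le> h * (W * (L * (C * h ^ (min k M + 2))))"
          using h by (simp add: abs_mult)
        have "ln (y (a + \<tau> m * h) $ i) - ln (y a $ i) - u i =
            (ln (y (a + \<tau> m * h) $ i) - ln (y a $ i)
               - h * (\<Sum>j=0..M. quad_weight M \<tau> m j * g (y (a + \<tau> j * h)) i))
            + h * (\<Sum>j=0..M. quad_weight M \<tau> m j * (g (y (a + \<tau> j * h)) i - g (w j) i))"
          by (simp add: u_def sum_subtractf right_diff_distrib)
        then have "\<bar>ln (y (a + \<tau> m * h) $ i) - ln (y a $ i) - u i\<bar>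
            \<le> A * h ^ (M + 2) + h * (W * (L * (C * h ^ (min k M + 2))))"
          using quad[OF h(1-3) m, of i] propagated unfolding g_def by linarith
        also have "\<dots> = A * h ^ (M + 2) + W * L * C * h ^ (min k M + 3)"
          by (simp add: eval_nat_numeral mult_ac)
        also have "\<dots> \<le> A * h ^ (min (Suc k) M + 2) + W * L * C * h ^ (min (Suc k) M + 2)"
        proof -
          have "min (Suc k) M + 2 \<le> M + 2" "min (Suc k) M + 2 \<le> min k M + 3"
            by linarith+
          then have "h ^ (M + 2) \<le> h ^ (min (Suc k) M + 2)" "h ^ (min k M + 3) \<le> h ^ (min (Suc k) M + 2)"
            using h by (auto intro: power_decreasing simp del: add_2_eq_Suc')
          then show ?thesis
            using A W0 lip(2) C by (intro add_mono mult_left_mono) auto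
        qed
        finally show ?thesis by (simp add: A'_def algebra_simps)
      qed
      have "spidec_stage f M \<tau> h (y a) (Suc k) m = (\<chi> i. y a $ i * exp (u i))"
        by (simp add: u_def g_def w_def)
      then show "norm (spidec_stage f M \<tau> h (y a) (Suc k) m - y (a + \<tau> m * h))
          \<le> 2 * real CARD('n) * \<bar>Y\<bar> * A' * h ^ (min (Suc k) M + 2)"
        using update[OF h(1-3) m h3(2)[OF h(1,6)] ln_error] by (simp add: mult.assoc)
    qed (use A' h1 h2 h3 in auto)
  qed
qed

section \<open>Consistency\<close>

theorem theorem4p1:
  fixes D \<Omega> :: "(real^'n) set"
    and f :: "real^'n \<Rightarrow> real^'n"
    and y :: "real \<Rightarrow> real^'n"
    and y0 :: "real^'n"
    and T \<alpha> \<beta> :: real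
    and M Nk p q :: nat
    and \<tau> :: "nat \<Rightarrow> real"
  assumes "0 < T"
    and "open D" and "pos_orthant \<subseteq> D"
    and "y0 \<in> pos_orthant"
    and "ode_solution D f T y" and "y 0 = y0"
    and "forward_invariant pos_orthant D f T"
    and "0 \<le> \<tau> 0" and "strict_mono_on {0..M} \<tau>" and "\<tau> M = 1"
    and "q = max (M + 1) (Nk + 1)"
    and "p = min (M + 1) (Nk + 1)"
    and "\<alpha> = (INF (i, t)\<in>UNIV \<times> {0..T}. \<bar>y t $ i\<bar>)"
    and "\<beta> = (MAX i. Linf_norm {0..T} (\<lambda>t. y t $ i))"
    and "compact \<Omega>" and "\<Omega> \<subseteq> pos_orthant"
    and "Ck_on q \<Omega> f"
    and "{\<omega>. \<forall>i. 0 < \<alpha> \<and> \<alpha> \<le> \<omega> $ i \<and> \<omega> $ i \<le> \<beta>} \<subseteq> interior \<Omega>"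
  shows "spidec_consistent f M Nk \<tau> y T p"
proof -
  have sol: "(y has_vector_derivative f (y t)) (at t within {0..T})" if "t \<in> {0..T}" for t
    using \<open>ode_solution D f T y\<close> that by (simp add: ode_solution_def)
  have cont: "continuous_on {0..T} y"
    using sol by (meson continuous_on_eq_continuous_within has_vector_derivative_continuous)
  have "y t \<in> pos_orthant" if "t \<in> {0..T}" for t
    using assms(4-7) that unfolding forward_invariant_def by blast
  then have pos: "0 < y t $ i" if "t \<in> {0..T}" for t i
    using that by (simp add: pos_orthant_def)
  note box = trajectory_in_box[OF \<open>0 < T\<close> cont pos assms(13,14)]
  then have int: "y t \<in> interior \<Omega>" if "t \<in> {0..T}" for t
    using assms(18) that by blast
  have inj: "inj_on \<tau> {0..M}"
    using assms(9) by (rule strict_mono_on_imp_inj_on)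
  have \<tau>: "\<tau> j \<in> {0..1}" if "j \<le> M" for j
    using strict_mono_on_leD[OF assms(9), of 0 j] strict_mono_on_leD[OF assms(9), of j M] that assms(8,10)
    by simp
  have "compact (y ` {0..T})" "y ` {0..T} \<subseteq> interior \<Omega>"
    using compact_continuous_image[OF cont compact_Icc] int by auto
  moreover obtain q' where "q = Suc q'"
    using assms(11) by (cases q) auto
  ultimately obtain e L where lip: "0 < e" "0 \<le> L"
    "\<And>x z i. x \<in> y ` {0..T} \<Longrightarrow> norm (z - x) \<le> e \<Longrightarrow>
      \<bar>f z $ i / z $ i - f x $ i / x $ i\<bar> \<le> L * norm (z - x)"
    using ratio_lipschitz_near_compact[OF assms(15,16)] assms(17) by metis
  \<comment> \<open>\<open>P i A\<close>: the logarithmic increments of component \<open>i\<close> have both error bounds with constant \<open>A\<close>.\<close>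
  define P where "P i A \<longleftrightarrow> (\<forall>a h m. 0 < h \<longrightarrow> 0 \<le> a \<longrightarrow> a + h \<le> T \<longrightarrow> m \<le> M \<longrightarrow>
      \<bar>ln (y (a + \<tau> m * h) $ i) - ln (y a $ i) - h * \<tau> m * (f (y a) $ i / y a $ i)\<bar> \<le> A * h\<^sup>2 \<and>
      \<bar>ln (y (a + \<tau> m * h) $ i) - ln (y a $ i) - h * (\<Sum>j=0..M. quad_weight M \<tau> m j *
         (f (y (a + \<tau> j * h)) $ i / y (a + \<tau> j * h) $ i))\<bar> \<le> A * h ^ (M + 2))" for i A
  have "\<exists>A\<ge>0. P i A" for i
    unfolding P_def
  proof (rule increment_error_bounds[OF _ _ inj \<tau>])
    show "((\<lambda>t. ln (y t $ i)) has_real_derivative f (y t) $ i / y t $ i) (at t within {0..T})"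
      if "t \<in> {0..T}" for t
      using ln_solution_derivative(1)[OF sol int assms(17) pos] that by blast
    show "Ck_within (M + 1) {0..T} (\<lambda>t. f (y t) $ i / y t $ i)"
      by (rule Ck_within_mono[OF ln_solution_derivative(2)[OF sol int assms(17) pos]])
         (use assms(11) in auto)
  qed
  then obtain A where A0: "\<And>i. 0 \<le> A i" and PA: "\<And>i. P i (A i)"
    by metis
  define S where "S = (\<Sum>i\<in>UNIV. A i)"
  have "A i \<le> S" for i
    unfolding S_def using A0 by (intro member_le_sum) auto
  then have AS: "A i * h ^ r \<le> S * h ^ r" if "0 < h" for i h r
    using that by (intro mult_right_mono) auto
  have "\<exists>C\<ge>0. \<exists>h0>0. \<forall>h a m. 0 < h \<longrightarrow> h \<le> h0 \<longrightarrow> 0 \<le> a \<longrightarrow> a + h \<le> T \<longrightarrow> m \<le> M \<longrightarrow>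
    norm (spidec_stage f M \<tau> h (y a) Nk m - y (a + \<tau> m * h)) \<le> C * h ^ (min Nk M + 2)"
  proof (rule spidec_stage_error[where Y = \<beta> and e = e and L = L and A = S])
    show "0 \<le> S" unfolding S_def using A0 by (intro sum_nonneg)
    show "\<bar>f z $ i / z $ i - f (y t) $ i / y t $ i\<bar> \<le> L * norm (z - y t)"
      if "t \<in> {0..T}" "norm (z - y t) \<le> e" for t z i
      using that by (intro lip(3)) auto
    fix a h :: real and m i
    assume h: "0 < h" "0 \<le> a" "a + h \<le> T" "m \<le> M"
    note PA[of i, unfolded P_def, rule_format, OF h]
    with AS[OF h(1), of i 2] AS[OF h(1), of i "M + 2"]
    show "\<bar>ln (y (a + \<tau> m * h) $ i) - ln (y a $ i) - h * \<tau> m * (f (y a) $ i / y a $ i)\<bar> \<le> S * h\<^sup>2"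
      and "\<bar>ln (y (a + \<tau> m * h) $ i) - ln (y a $ i) - h * (\<Sum>j=0..M. quad_weight M \<tau> m j *
         (f (y (a + \<tau> j * h)) $ i / y (a + \<tau> j * h) $ i))\<bar> \<le> S * h ^ (M + 2)"
      by linarith+
  qed (use pos box(3) \<tau> lip(1,2) in auto)
  then obtain C h0 where h0: "0 < h0" and C: "\<And>h a m. 0 < h \<Longrightarrow> h \<le> h0 \<Longrightarrow> 0 \<le> a \<Longrightarrow> a + h \<le> T \<Longrightarrow>
    m \<le> M \<Longrightarrow> norm (spidec_stage f M \<tau> h (y a) Nk m - y (a + \<tau> m * h)) \<le> C * h ^ (min Nk M + 2)"
    by blast
  show ?thesis
    unfolding spidec_consistent_def Let_def
  proof (rule exI[of _ C], intro conjI exI[of _ h0] allI impI)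
    fix Nt n :: nat
    assume Nt: "1 \<le> Nt" and le_h0: "T / real Nt \<le> h0" and n: "n < Nt"
    define h where "h = T / real Nt"
    have h: "0 < h" "h \<le> h0" "0 \<le> real n * h"
      using Nt le_h0 \<open>0 < T\<close> by (auto simp: h_def)
    have "real n * h + h = real (Suc n) * h"
      by (simp add: algebra_simps)
    also have "\<dots> \<le> real Nt * h"
      using n h by (intro mult_right_mono) auto
    also have "\<dots> = T"
      using Nt by (simp add: h_def)
    finally have "real n * h + h \<le> T" .
    from C[OF h this order_refl]
    have "norm (spidec_local_error f M Nk \<tau> y h n) \<le> C * h ^ (p + 1)"
      using assms(10,12) by (simp add: spidec_local_error_def spidec_step_def norm_minus_commute
          algebra_simps min.commute min_add_distrib_left)
    then have "\<bar>spidec_local_error f M Nk \<tau> y h n $ i\<bar> \<le> C * h ^ (p + 1)" for i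
      using component_le_norm_cart order_trans by blast
    then show "(MAX i. \<bar>spidec_local_error f M Nk \<tau> y (T / real Nt) n $ i\<bar>) \<le> C * (T / real Nt) ^ (p + 1)"
      unfolding h_def[symmetric] by (intro Max.boundedI) auto
  qed (rule h0)
qed

end
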